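(* Let $k>1$ and $\ell>0$ be integers. If a graph $G$ satisfies $\alpha(G)<k$ and $c_v(G)\ge \max\{k\ell,10\ell\}$, then $G$ is Hamiltonian-$\ell$-linked.
   Context: Graphs are finite, simple and undirected. $\alpha(G)$ is the independence number of $G$. A vertex cut of $G$ is a set $A\subset V(G)$ such that $G-A$ is disconnected; the vertex connectivity $c_v(G)$ is the minimum size of a vertex cut of $G$, or $|V(G)|-1$ if $G$ is complete. A graph $G$ is Hamiltonian-$\ell$-linked if it has at least $2\ell$ vertices and for every sequence of distinct vertices $s_1,\dots,s_\ell,t_1,\dots,t_\ell$ there exist pairwise vertex-disjoint paths $P_1,\dots,P_\ell$ such that $P_i$ has end-vertices $s_i$ and $t_i$ for each $i$, and $\bigcup_{i=1}^\ell V(P_i)=V(G)$. *)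

theory Defs
  imports "HOL-Library.Disjoint_Sets" "Graph_Theory.Graph_Theory"
begin

text \<open>
  A finite simple undirected graph is a \<^locale>\<open>graph\<close>: a finite symmetric digraph
  without loops and parallel arcs, each edge being a pair of opposite arcs.
\<close>

definition independent_set :: "('a,'b) pre_digraph \<Rightarrow> 'a set \<Rightarrow> bool" where
  "independent_set G S \<longleftrightarrow> S \<subseteq> verts G \<and> (\<forall>u\<in>S. \<forall>v\<in>S. (u, v) \<notin> arcs_ends G)"

definition independence_number :: "('a,'b) pre_digraph \<Rightarrow> nat" where
  "independence_number G = Max (card ` {S. independent_set G S})"

text \<open>
  \<^const>\<open>Digraph_Component.connected\<close> is false for the graph without vertices; the strict
  inclusion keeps the whole vertex set from being a vertex cut.
\<close>

definition vertex_cut :: "('a,'b) pre_digraph \<Rightarrow> 'a set \<Rightarrow> bool" where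
  "vertex_cut G A \<longleftrightarrow>
     A \<subset> verts G \<and> \<not> Digraph_Component.connected (G \<restriction> (verts G - A))"

text \<open>
  A graph without vertices counts as complete and gets connectivity 0.
\<close>

definition vertex_connectivity :: "('a,'b) pre_digraph \<Rightarrow> nat" where
  "vertex_connectivity G =
     (if complete_digraph (card (verts G)) G then card (verts G) - 1
      else Min (card ` {A. vertex_cut G A}))"

definition hamiltonian_linked :: "nat \<Rightarrow> ('a,'b) pre_digraph \<Rightarrow> bool" where
  "hamiltonian_linked l G \<longleftrightarrow>
     2 * l \<le> card (verts G) \<and>
     (\<forall>s t. length s = l \<and> length t = l \<and> distinct (s @ t) \<and> set (s @ t) \<subseteq> verts G \<longrightarrow>
        (\<exists>P :: nat \<Rightarrow> 'a list.
           (\<forall>i<l. vpath (P i) G \<and> hd (P i) = s ! i \<and> last (P i) = t ! i) \<and>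
           disjoint_family_on (\<lambda>i. set (P i)) {..<l} \<and>
           (\<Union>i<l. set (P i)) = verts G))"

end

theory Submission
  imports Defs
begin

text \<open>
  Since \<open>\<alpha>(G) < k\<close> may be weakened to \<open>\<alpha>(G) < max k 10\<close>, we may assume \<open>k \<ge> 4\<close> and connectivity at
  least \<open>k\<ell>\<close>. A linkage is found by induction on \<open>\<ell>\<close>. If there is a clique on \<open>2\<ell>\<close> vertices, the
  terminals are linked to it by Menger's theorem. Otherwise consider the distance layers between
  \<open>s\<^sub>1\<close> and \<open>t\<^sub>1\<close> in the graph without the other terminals: every layer separates, so it has at least
  \<open>k\<ell> - 2(\<ell> - 1) \<ge> 2\<ell>\<close> vertices and is not a clique. Two nonadjacent vertices from every second layer
  form an independent set, which bounds the number of vertices of a shortest path by \<open>k\<close>; delete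
  the path and continue with connectivity \<open>k(\<ell> - 1)\<close>. Finally, a linkage covering the maximum number
  of vertices is spanning, by the rotation argument of Chvatal and Erdos.
\<close>

section \<open>Walks\<close>

text \<open>A bare relation stands for the arcs, so that Menger's theorem can be proved by removing
  one ordered pair at a time.\<close>

definition walk :: "('a \<times> 'a) set \<Rightarrow> 'a list \<Rightarrow> bool" where
  "walk E p \<longleftrightarrow> p \<noteq> [] \<and> successively (\<lambda>x y. (x, y) \<in> E) p"

lemma walk_single [simp]: "walk E [x]"
  by (simp add: walk_def)

lemma walk_append:
  "p \<noteq> [] \<Longrightarrow> q \<noteq> [] \<Longrightarrow> walk E (p @ q) \<longleftrightarrow> walk E p \<and> walk E q \<and> (last p, hd q) \<in> E"
  by (auto simp: walk_def successively_append_iff)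

lemma walk_splitD:
  assumes "walk E (a @ w # b)"
  shows "walk E (a @ [w])" "walk E (w # b)"
  using assms by (auto simp: walk_def successively_append_iff successively_Cons)

lemma walk_joinI:
  assumes "walk E (a @ [w])" "walk E (w # b)"
  shows "walk E (a @ w # b)"
  using assms by (auto simp: walk_def successively_append_iff successively_Cons)

lemma walk_mono: "walk E p \<Longrightarrow> E \<subseteq> F \<Longrightarrow> walk F p"
  unfolding walk_def by (auto elim: successively_mono)

lemma walk_rev:
  assumes "sym E" "walk E p"
  shows "walk E (rev p)"
proof -
  have "successively (\<lambda>x y. (y, x) \<in> E) p"
    using assms(2) unfolding walk_def
    by (auto elim: successively_mono intro: symD[OF assms(1)])
  then show ?thesis using assms(2) by (simp add: walk_def)
qed

lemma walk_Cons_Cons [simp]: "walk E (a # b # p) \<longleftrightarrow> (a, b) \<in> E \<and> walk E (b # p)"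
  by (simp add: walk_def)

text \<open>Using the arc \<open>(x, y)\<close> means leaving \<open>x\<close>, which is impossible
  if \<open>x\<close> occurs at most as the last vertex. The next lemma is the mirror image:
  \<open>y\<close> is never entered after the start.\<close>

lemma walk_insert_butlast:
  "walk (insert (x, y) E) p \<Longrightarrow> x \<notin> set (butlast p) \<Longrightarrow> walk E p"
proof (induction p rule: induct_list012)
  case (3 a b p)
  then show ?case by auto
qed (auto simp: walk_def)

lemma walk_insert_tl:
  "walk (insert (x, y) E) p \<Longrightarrow> y \<notin> set (tl p) \<Longrightarrow> walk E p"
proof (induction p rule: induct_list012)
  case (3 a b p)
  then have "walk E (b # p)" by (intro "3.IH") auto
  then show ?case using 3 by auto
qed (auto simp: walk_def)

lemma walk_subset:
  assumes "walk E p" "E \<subseteq> V \<times> V" "hd p \<in> V"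
  shows "set p \<subseteq> V"
  using assms unfolding walk_def
proof (induction p)
  case (Cons a p)
  then show ?case by (cases p) (auto simp: successively_Cons)
qed simp

section \<open>Menger's theorem\<close>

text \<open>Walks of one vertex count, so a separator contains \<open>A \<inter> B\<close>; it may
  use vertices of \<open>A\<close> and \<open>B\<close>.\<close>

definition separates :: "('a \<times> 'a) set \<Rightarrow> 'a set \<Rightarrow> 'a set \<Rightarrow> 'a set \<Rightarrow> bool" where
  "separates E A B S \<longleftrightarrow>
     (\<forall>p. walk E p \<longrightarrow> hd p \<in> A \<longrightarrow> last p \<in> B \<longrightarrow> set p \<inter> S \<noteq> {})"

text \<open>The paths may meet \<open>A\<close> and \<open>B\<close> in inner vertices. The index
  lemmas below exclude this on a side whose vertices are all ends of paths.\<close>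

definition connector :: "('a \<times> 'a) set \<Rightarrow> 'a set \<Rightarrow> 'a set \<Rightarrow> 'a list set \<Rightarrow> bool" where
  "connector E A B Q \<longleftrightarrow> finite Q \<and> disjoint_family_on set Q \<and>
     (\<forall>p\<in>Q. walk E p \<and> distinct p \<and> hd p \<in> A \<and> last p \<in> B)"

lemma disjoint_family_eqI:
  "disjoint_family_on set Q \<Longrightarrow> p \<in> Q \<Longrightarrow> q \<in> Q \<Longrightarrow> w \<in> set p \<Longrightarrow> w \<in> set q \<Longrightarrow> p = q"
  unfolding disjoint_family_on_def by blast

lemma connector_inj_on:
  assumes "connector E A B Q"
  shows "inj_on hd Q" "inj_on last Q"
proof -
  have *: "disjoint_family_on set Q" "\<And>p. p \<in> Q \<Longrightarrow> p \<noteq> []"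
    using assms by (auto simp: connector_def walk_def)
  show "inj_on hd Q" "inj_on last Q"
    by (auto intro!: inj_onI dest: *(2) intro: disjoint_family_eqI[OF *(1)])
      (metis * disjoint_family_eqI hd_in_set last_in_set)+
qed

text \<open>By counting, the heads exhaust \<open>A\<close>, so the paths can be indexed by their
  starting points. A further vertex of \<open>A\<close> on a path would be the head of another path,
  against disjointness.\<close>

lemma connector_hd_index:
  assumes "connector E A B Q" "finite A" "card A = card Q"
  shows "\<exists>g. (\<forall>z\<in>A. walk E (g z) \<and> distinct (g z) \<and> hd (g z) = z \<and> last (g z) \<in> B) \<and>
    disjoint_family_on (set \<circ> g) A \<and> (\<forall>z\<in>A. set (g z) \<inter> A = {z})"
proof -
  have inj: "inj_on hd Q" by (rule connector_inj_on[OF assms(1)])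
  have "hd ` Q \<subseteq> A" using assms(1) by (auto simp: connector_def)
  then have img: "hd ` Q = A"
    using assms inj by (simp add: card_image card_subset_eq)
  define g where "g = inv_into Q hd"
  have gQ: "g z \<in> Q" "hd (g z) = z" if "z \<in> A" for z
    using that img unfolding g_def by (auto intro: inv_into_into f_inv_into_f)
  have *: "walk E (g z) \<and> distinct (g z) \<and> hd (g z) = z \<and> last (g z) \<in> B" if "z \<in> A" for z
    using gQ[OF that] assms(1) by (auto simp: connector_def)
  have in_g: "z \<in> set (g z)" if "z \<in> A" for z
    using *[OF that] by (metis hd_in_set walk_def)
  have disj: "z = z'" if "z \<in> A" "z' \<in> A" "w \<in> set (g z)" "w \<in> set (g z')" for z z' w
    using that gQ assms(1) unfolding connector_def by (metis disjoint_family_eqI)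
  show ?thesis
    using * in_g disj[OF _ _ _ in_g]
    by (intro exI[of _ g]) (auto simp: disjoint_family_on_def dest: disj)
qed

lemma connector_last_index:
  assumes "connector E A B Q" "finite B" "card B = card Q"
  shows "\<exists>f. (\<forall>z\<in>B. walk E (f z) \<and> distinct (f z) \<and> hd (f z) \<in> A \<and> last (f z) = z) \<and>
    disjoint_family_on (set \<circ> f) B \<and> (\<forall>z\<in>B. set (f z) \<inter> B = {z})"
proof -
  have inj: "inj_on last Q" by (rule connector_inj_on[OF assms(1)])
  have "last ` Q \<subseteq> B" using assms(1) by (auto simp: connector_def)
  then have img: "last ` Q = B"
    using assms inj by (simp add: card_image card_subset_eq)
  define f where "f = inv_into Q last"
  have fQ: "f z \<in> Q" "last (f z) = z" if "z \<in> B" for z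
    using that img unfolding f_def by (auto intro: inv_into_into f_inv_into_f)
  have *: "walk E (f z) \<and> distinct (f z) \<and> hd (f z) \<in> A \<and> last (f z) = z" if "z \<in> B" for z
    using fQ[OF that] assms(1) by (auto simp: connector_def)
  have in_f: "z \<in> set (f z)" if "z \<in> B" for z
    using *[OF that] by (metis last_in_set walk_def)
  have disj: "z = z'" if "z \<in> B" "z' \<in> B" "w \<in> set (f z)" "w \<in> set (f z')" for z z' w
    using that fQ assms(1) unfolding connector_def by (metis disjoint_family_eqI)
  show ?thesis
    using * in_f disj[OF _ _ _ in_f]
    by (intro exI[of _ f]) (auto simp: disjoint_family_on_def dest: disj)
qed

text \<open>
  Induction on the arcs, after Goering: if deleting the arc \<open>(x, y)\<close> admits a separator \<open>S\<close> with
  fewer than \<open>n\<close> vertices, then \<open>S \<union> {x}\<close> and \<open>S \<union> {y}\<close> separate with the arc present and have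
  exactly \<open>n\<close> vertices. Connectors from \<open>A\<close> to the first and from the second to \<open>B\<close> exist without the
  arc; they can only meet in \<open>S\<close>, so they compose along \<open>S\<close> and the arc.
\<close>

theorem menger:
  assumes "finite E" "finite A"
    and "\<And>S. finite S \<Longrightarrow> separates E A B S \<Longrightarrow> n \<le> card S"
  shows "\<exists>Q. connector E A B Q \<and> card Q = n"
  using assms
proof (induction E arbitrary: A B n rule: finite_induct)
  case empty
  have "separates {} A B (A \<inter> B)"
    unfolding separates_def
  proof (intro allI impI)
    fix p assume "walk {} p" "hd p \<in> A" "last p \<in> B"
    then show "set p \<inter> (A \<inter> B) \<noteq> {}"
      by (cases p) (auto simp: walk_def successively_Cons split: if_splits)
  qed
  then have "n \<le> card (A \<inter> B)" using empty by auto
  then obtain T where T: "T \<subseteq> A \<inter> B" "card T = n" "finite T"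
    using obtain_subset_with_card_n by metis
  have "connector {} A B ((\<lambda>x. [x]) ` T)"
    using T by (auto simp: connector_def disjoint_family_on_def)
  moreover have "card ((\<lambda>x. [x]) ` T) = n"
    using T by (subst card_image) (auto simp: inj_on_def)
  ultimately show ?case by blast
next
  case (insert e E)
  obtain x y where e: "e = (x, y)" by (cases e)
  let ?E = "insert (x, y) E"
  show ?case
  proof (cases "\<forall>S. finite S \<longrightarrow> separates E A B S \<longrightarrow> n \<le> card S")
    case True
    then obtain Q where "connector E A B Q" "card Q = n"
      using insert.IH[of A B n] insert.prems(1) by auto
    then have "connector (insert e E) A B Q"
      using walk_mono[of E _ "insert e E"] by (auto simp: connector_def)
    then show ?thesis using \<open>card Q = n\<close> by blast
  next
    case False
    then obtain S where S: "finite S" "separates E A B S" "card S < n" by auto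
    have sepx: "separates ?E A B (insert x S)"
      unfolding separates_def
    proof (intro allI impI)
      fix p assume p: "walk ?E p" "hd p \<in> A" "last p \<in> B"
      show "set p \<inter> insert x S \<noteq> {}"
      proof (cases "x \<in> set p")
        case False
        then have "walk E p" using p walk_insert_butlast by (metis in_set_butlastD)
        then show ?thesis using p S(2) by (auto simp: separates_def)
      qed auto
    qed
    have sepy: "separates ?E A B (insert y S)"
      unfolding separates_def
    proof (intro allI impI)
      fix p assume p: "walk ?E p" "hd p \<in> A" "last p \<in> B"
      show "set p \<inter> insert y S \<noteq> {}"
      proof (cases "y \<in> set p")
        case False
        then have "walk E p" using p walk_insert_tl by (metis list.set_sel(2) tl_Nil)
        then show ?thesis using p S(2) by (auto simp: separates_def)
      qed auto
    qed
    \<comment> \<open>Since \<open>n \<le> card (insert x S) \<le> card S + 1 \<le> n\<close>, the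
      added vertex is new and equality holds; likewise for \<open>y\<close>.\<close>
    have cx: "x \<notin> S" "card (insert x S) = n" and cy: "y \<notin> S" "card (insert y S) = n"
      using insert.prems(2)[of "insert x S"] insert.prems(2)[of "insert y S"] sepx sepy S
      by (auto simp: e card_insert_if split: if_splits)
    \<comment> \<open>\<open>T\<close> separates \<open>A\<close> from \<open>B\<close> even with
      the new arc: up to its first vertex in \<open>insert x S\<close> a walk never leaves
      \<open>x\<close>, so this segment lies in \<open>E\<close> and meets \<open>T\<close>. For
      \<open>Q2\<close> below, the segment from the last vertex in \<open>insert y S\<close> is
      used.\<close>
    have "n \<le> card T" if T: "finite T" "separates E A (insert x S) T" for T
    proof (rule insert.prems(2)[OF T(1)], unfold separates_def e, intro allI impI)
      fix p assume p: "walk ?E p" "hd p \<in> A" "last p \<in> B"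
      then have "\<exists>z\<in>set p. z \<in> insert x S" using sepx by (auto simp: separates_def)
      from split_list_first_prop[OF this]
      obtain a z b where ab: "p = a @ z # b" "z \<in> insert x S" "\<forall>w\<in>set a. w \<notin> insert x S"
        by blast
      have "walk ?E (a @ [z])" using p(1) unfolding ab(1) by (rule walk_splitD)
      then have "walk E (a @ [z])" using ab(3) walk_insert_butlast by fastforce
      moreover have "hd (a @ [z]) \<in> A" using p(2) ab(1) by (cases a) auto
      ultimately have "set (a @ [z]) \<inter> T \<noteq> {}"
        using T(2) ab(2) unfolding separates_def by (metis last_snoc)
      then show "set p \<inter> T \<noteq> {}" using ab(1) by auto
    qed
    then obtain Q1 where Q1: "connector E A (insert x S) Q1" "card Q1 = n"
      using insert.IH[of A "insert x S" n] insert.prems(1) by blast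
    have "n \<le> card T" if T: "finite T" "separates E (insert y S) B T" for T
    proof (rule insert.prems(2)[OF T(1)], unfold separates_def e, intro allI impI)
      fix p assume p: "walk ?E p" "hd p \<in> A" "last p \<in> B"
      then have "\<exists>z\<in>set p. z \<in> insert y S" using sepy by (auto simp: separates_def)
      from split_list_last_prop[OF this]
      obtain a z b where ab: "p = a @ z # b" "z \<in> insert y S" "\<forall>w\<in>set b. w \<notin> insert y S"
        by blast
      have "walk ?E (z # b)" using p(1) unfolding ab(1) by (rule walk_splitD)
      then have "walk E (z # b)" using ab(3) walk_insert_tl by fastforce
      moreover have "last (z # b) \<in> B" using p(3) ab(1) by auto
      ultimately have "set (z # b) \<inter> T \<noteq> {}"
        using T(2) ab(2) unfolding separates_def by (metis list.sel(1))
      then show "set p \<inter> T \<noteq> {}" using ab(1) by auto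
    qed
    then obtain Q2 where Q2: "connector E (insert y S) B Q2" "card Q2 = n"
      using insert.IH[of "insert y S" B n] S(1) by blast
    have "\<exists>f. (\<forall>z\<in>insert x S. walk E (f z) \<and> distinct (f z) \<and> hd (f z) \<in> A \<and> last (f z) = z) \<and>
        disjoint_family_on (set \<circ> f) (insert x S) \<and> (\<forall>z\<in>insert x S. set (f z) \<inter> insert x S = {z})"
      by (rule connector_last_index[OF Q1(1)]) (use S(1) Q1(2) cx in auto)
    then obtain f where f_all: "\<forall>z\<in>insert x S.
          walk E (f z) \<and> distinct (f z) \<and> hd (f z) \<in> A \<and> last (f z) = z"
      and f_fam: "disjoint_family_on (set \<circ> f) (insert x S)"
      and f_meet: "\<forall>z\<in>insert x S. set (f z) \<inter> insert x S = {z}"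
      by (elim exE conjE)
    note f = bspec[OF f_all]
    have f_disj: "z = z'" if "z \<in> insert x S" "z' \<in> insert x S" "w \<in> set (f z)" "w \<in> set (f z')" for z z' w
      using disjoint_family_onD[OF f_fam that(1,2)] that(3,4) by auto
    have f_end: "w = z" if "z \<in> insert x S" "w \<in> insert x S" "w \<in> set (f z)" for z w
      using bspec[OF f_meet that(1)] that(2,3) by auto
    have "\<exists>g. (\<forall>z\<in>insert y S. walk E (g z) \<and> distinct (g z) \<and> hd (g z) = z \<and> last (g z) \<in> B) \<and>
        disjoint_family_on (set \<circ> g) (insert y S) \<and> (\<forall>z\<in>insert y S. set (g z) \<inter> insert y S = {z})"
      by (rule connector_hd_index[OF Q2(1)]) (use S(1) Q2(2) cy in auto)
    then obtain g where g_all: "\<forall>z\<in>insert y S.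
          walk E (g z) \<and> distinct (g z) \<and> hd (g z) = z \<and> last (g z) \<in> B"
      and g_fam: "disjoint_family_on (set \<circ> g) (insert y S)"
      and g_meet: "\<forall>z\<in>insert y S. set (g z) \<inter> insert y S = {z}"
      by (elim exE conjE)
    note g = bspec[OF g_all]
    have g_disj: "z = z'" if "z \<in> insert y S" "z' \<in> insert y S" "w \<in> set (g z)" "w \<in> set (g z')" for z z' w
      using disjoint_family_onD[OF g_fam that(1,2)] that(3,4) by auto
    have g_end: "w = z" if "z \<in> insert y S" "w \<in> insert y S" "w \<in> set (g z)" for z w
      using bspec[OF g_meet that(1)] that(2,3) by auto
    \<comment> \<open>The first path up to \<open>w\<close> followed by the second from
      \<open>w\<close> is a walk from \<open>A\<close> to \<open>B\<close> without the new arc, so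
      it meets \<open>S\<close>. Such a vertex can only be the end of the first path or the start of
      the second, and distinctness makes it \<open>w\<close>.\<close>
    have meet: "w = z \<and> w = z' \<and> w \<in> S"
      if z: "z \<in> insert x S" and z': "z' \<in> insert y S"
        and w: "w \<in> set (f z)" "w \<in> set (g z')" for z z' w
    proof -
      obtain a b where ab: "f z = a @ w # b" using w(1) by (meson split_list)
      obtain c d where cd: "g z' = c @ w # d" using w(2) by (meson split_list)
      have "walk E (a @ w # d)"
        using f[OF z] g[OF z'] unfolding ab cd by (metis walk_splitD walk_joinI)
      moreover have "hd (a @ w # d) \<in> A" using f[OF z] unfolding ab by (cases a) auto
      moreover have "last (a @ w # d) \<in> B" using g[OF z'] unfolding cd by auto
      ultimately obtain v where v: "v \<in> S" "v \<in> set (a @ w # d)"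
        using S(2) unfolding separates_def by blast
      have "w \<in> S"
      proof (cases "v \<in> set (a @ [w])")
        case True
        then have "v = z" using f_end[OF z, of v] v(1) ab by auto
        moreover have "last (w # b) = z" using f[OF z] ab by auto
        moreover have "distinct (a @ w # b)" using f[OF z] ab by auto
        ultimately have "v = w" using True by (auto split: if_splits)
        then show ?thesis using v(1) by simp
      next
        case False
        then have vd: "v \<in> set d" using v(2) by auto
        then have "v = z'" using g_end[OF z', of v] v(1) cd by auto
        moreover have "hd (c @ [w]) = z'" using g[OF z'] cd by (cases c) auto
        moreover have "distinct (c @ w # d)" using g[OF z'] cd by auto
        ultimately have "v = w" using vd by (cases c) auto
        then show ?thesis using v(1) by simp
      qed
      then show ?thesis using f_end[OF z, of w] g_end[OF z', of w] w by auto
    qed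
    \<comment> \<open>\<open>\<sigma>\<close> tells which second path continues the one ending in
      \<open>z\<close>: the arc leads from \<open>x\<close> to \<open>y\<close>, while any other
      \<open>z\<close> is shared by both paths, whence the \<open>tl\<close> in
      \<open>h\<close>.\<close>
    define \<sigma> where "\<sigma> z = (if z = x then y else z)" for z
    define h where "h z = (if z = x then f x @ g y else f z @ tl (g z))" for z
    have \<sigma>: "\<sigma> z \<in> insert y S" if "z \<in> insert x S" for z using that by (auto simp: \<sigma>_def)
    have g_Cons: "g z = z # tl (g z)" if "z \<in> insert y S" for z
      using g[OF that] by (cases "g z") (auto simp: walk_def)
    have seth: "set (h z) \<subseteq> set (f z) \<union> set (g (\<sigma> z))" if "z \<in> insert x S" for z
      using that by (auto simp: h_def \<sigma>_def dest: list.set_sel(2)[rotated])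
        (metis list.set_sel(2) tl_Nil)
    have hne: "h z \<noteq> []" if "z \<in> insert x S" for z
      using f[OF that] by (auto simp: h_def walk_def)
    have h: "walk ?E (h z) \<and> distinct (h z) \<and> hd (h z) \<in> A \<and> last (h z) \<in> B"
      if z: "z \<in> insert x S" for z
    proof (cases "z = x")
      case True
      have "set (f x) \<inter> set (g y) = {}"
        using meet[of x y] cx(1) by blast
      moreover have "walk ?E (f x @ g y)"
        using f[of x] g[of y] walk_mono[of E _ ?E] walk_append[of "f x" "g y" ?E]
        by (auto simp: walk_def)
      ultimately show ?thesis
        using f[of x] g[of y] True by (auto simp: h_def walk_def)
    next
      case False
      then have zS: "z \<in> S" using z by auto
      have fz: "walk E (f z)" "distinct (f z)" "hd (f z) \<in> A" "last (f z) = z" using f[OF z] by auto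
      have gz: "walk E (g z)" "distinct (g z)" "hd (g z) = z" "last (g z) \<in> B" using g[of z] zS by auto
      have eq: "f z = butlast (f z) @ [z]"
        using fz by (metis append_butlast_last_id walk_def)
      have hz: "h z = butlast (f z) @ z # tl (g z)"
        using False arg_cong[OF eq, of "\<lambda>p. p @ tl (g z)"] by (simp add: h_def)
      have zg: "z # tl (g z) = g z" using g_Cons[of z] zS by simp
      have "walk E (h z)" unfolding hz
        by (rule walk_joinI) (simp_all only: zg eq[symmetric] fz(1) gz(1))
      moreover have "distinct (h z)"
      proof -
        have "z \<notin> set (tl (g z))" using gz(2) zg by (metis distinct.simps(2))
        moreover have "set (tl (g z)) \<subseteq> set (g z)" by (metis zg set_subset_Cons)
        ultimately have "set (f z) \<inter> set (tl (g z)) = {}"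
          using meet[of z z] zS by blast
        then show ?thesis using False fz gz by (simp add: h_def distinct_tl)
      qed
      moreover have "hd (h z) \<in> A" using fz False by (auto simp: h_def walk_def)
      moreover have "last (h z) \<in> B" unfolding hz zg using gz(1,4) by (simp add: walk_def)
      ultimately show ?thesis using walk_mono[of E "h z" ?E] by blast
    qed
    have h_disj: "z = z'"
      if z: "z \<in> insert x S" and z': "z' \<in> insert x S" and w: "w \<in> set (h z)" "w \<in> set (h z')"
      for z z' w
    proof -
      have fg: "u = u'" if u: "u \<in> insert x S" "u' \<in> insert x S" "w \<in> set (f u)" "w \<in> set (g (\<sigma> u'))" for u u'
        using meet[OF u(1) \<sigma>[OF u(2)] u(3,4)] cx cy by (auto simp: \<sigma>_def split: if_splits)
      have gg: "z = z'" if "w \<in> set (g (\<sigma> z))" "w \<in> set (g (\<sigma> z'))"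
        using g_disj[OF \<sigma>[OF z] \<sigma>[OF z'] that] z z' cy by (auto simp: \<sigma>_def split: if_splits)
      have "w \<in> set (f z) \<or> w \<in> set (g (\<sigma> z))" "w \<in> set (f z') \<or> w \<in> set (g (\<sigma> z'))"
        using seth[OF z] seth[OF z'] w by auto
      then show ?thesis
        using fg[OF z z'] fg[OF z' z] f_disj[OF z z'] gg by auto
    qed
    have "inj_on h (insert x S)"
    proof (rule inj_onI)
      fix z z' assume "z \<in> insert x S" "z' \<in> insert x S" "h z = h z'"
      then show "z = z'" using h_disj[of z z' "hd (h z)"] hne[of z] by auto
    qed
    then have "card (h ` insert x S) = n" using cx(2) card_image by metis
    moreover have "connector ?E A B (h ` insert x S)"
      unfolding connector_def
    proof (intro conjI)
      show "disjoint_family_on set (h ` insert x S)"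
        unfolding disjoint_family_on_def
      proof (intro ballI impI)
        fix p q assume "p \<in> h ` insert x S" "q \<in> h ` insert x S" "p \<noteq> q"
        then obtain z z' where "z \<in> insert x S" "z' \<in> insert x S" "p = h z" "q = h z'" "z \<noteq> z'"
          by (elim imageE) metis
        then show "set p \<inter> set q = {}" using h_disj[of z z'] by auto
      qed
      show "\<forall>p\<in>h ` insert x S. walk ?E p \<and> distinct p \<and> hd p \<in> A \<and> last p \<in> B"
        using h by blast
    qed (use S(1) in simp)
    ultimately show ?thesis unfolding e by blast
  qed
qed

section \<open>Linkages in graphs of small independence number\<close>

definition path_in :: "('a \<times> 'a) set \<Rightarrow> 'a set \<Rightarrow> 'a list \<Rightarrow> bool" where
  "path_in E V p \<longleftrightarrow> walk E p \<and> distinct p \<and> set p \<subseteq> V"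

text \<open>
  In contrast to the usual notion of \<open>c\<close>-connectedness, \<open>V\<close> may have at most \<open>c\<close> vertices.
\<close>

definition vertex_connected :: "('a \<times> 'a) set \<Rightarrow> 'a set \<Rightarrow> nat \<Rightarrow> bool" where
  "vertex_connected E V c \<longleftrightarrow>
     (\<forall>A\<subseteq>V. card A < c \<longrightarrow> (\<forall>u\<in>V - A. \<forall>v\<in>V - A. (u, v) \<in> rtrancl_on (V - A) E))"

definition indep :: "('a \<times> 'a) set \<Rightarrow> 'a set \<Rightarrow> bool" where
  "indep E S \<longleftrightarrow> (\<forall>u\<in>S. \<forall>v\<in>S. (u, v) \<notin> E)"

definition linkage ::
  "('a \<times> 'a) set \<Rightarrow> 'a set \<Rightarrow> nat \<Rightarrow> 'a list \<Rightarrow> 'a list \<Rightarrow> (nat \<Rightarrow> 'a list) \<Rightarrow> bool" where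
  "linkage E V l s t P \<longleftrightarrow>
     (\<forall>i<l. path_in E V (P i) \<and> hd (P i) = s ! i \<and> last (P i) = t ! i) \<and>
     disjoint_family_on (\<lambda>i. set (P i)) {..<l}"

lemma path_in_mono: "path_in E V p \<Longrightarrow> V \<subseteq> W \<Longrightarrow> path_in E W p"
  by (auto simp: path_in_def)

lemma rtrancl_on_path:
  assumes "(u, v) \<in> rtrancl_on F E"
  shows "\<exists>p. path_in E F p \<and> hd p = u \<and> last p = v"
  using assms
proof (induction rule: rtrancl_on_induct)
  case base
  then show ?case by (intro exI[of _ "[u]"]) (auto simp: path_in_def)
next
  case (step y z)
  then obtain p where p: "walk E p" "distinct p" "set p \<subseteq> F" "hd p = u" "last p = y"
    by (auto simp: path_in_def)
  show ?case
  proof (cases "z \<in> set p")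
    case True
    then obtain a b where ab: "p = a @ z # b" by (meson split_list)
    have "walk E (a @ [z])" using p(1) unfolding ab by (rule walk_splitD)
    moreover have "hd (a @ [z]) = u" using p(4) ab by (cases a) auto
    ultimately show ?thesis
      using p(2,3) ab by (intro exI[of _ "a @ [z]"]) (auto simp: path_in_def)
  next
    case False
    have "p \<noteq> []" using p(1) by (simp add: walk_def)
    then show ?thesis using p False step
      by (intro exI[of _ "p @ [z]"]) (auto simp: path_in_def walk_append)
  qed
qed

lemma walk_Int: "walk E p \<Longrightarrow> set p \<subseteq> V \<Longrightarrow> walk (E \<inter> V \<times> V) p"
proof (induction p rule: induct_list012)
  case (3 a b p)
  then show ?case by auto
qed (auto simp: walk_def)

lemma vertex_connected_mono: "vertex_connected E V c \<Longrightarrow> d \<le> c \<Longrightarrow> vertex_connected E V d"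
  unfolding vertex_connected_def by (meson less_le_trans)

text \<open>
  Menger's theorem yields disjoint paths from all terminals to the clique; the two paths starting
  at \<open>s ! i\<close> and \<open>t ! i\<close> are joined by an edge of the clique.
\<close>

lemma clique_linkage:
  assumes fin: "finite V" and sym: "sym E" and conn: "vertex_connected E V (2 * l)"
    and K: "K \<subseteq> V" "2 * l \<le> card K" "\<And>u v. u \<in> K \<Longrightarrow> v \<in> K \<Longrightarrow> u \<noteq> v \<Longrightarrow> (u, v) \<in> E"
    and st: "length s = l" "length t = l" "distinct (s @ t)" "set (s @ t) \<subseteq> V"
  shows "\<exists>P. linkage E V l s t P"
proof -
  \<comment> \<open>Restricting the arcs to \<open>V\<close> makes them finite, as Menger's theorem
    demands, and keeps the paths inside \<open>V\<close>.\<close>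
  let ?E = "E \<inter> V \<times> V" and ?A = "set (s @ t)"
  have cA: "card ?A = 2 * l" using st(1,2) distinct_card[OF st(3)] by simp
  \<comment> \<open>A smaller separator would miss a terminal and a vertex of \<open>K\<close>,
    since both sets have at least \<open>2 * l\<close> elements; connectivity joins these two
    outside it. As \<open>S\<close> may contain elements outside \<open>V\<close>, the argument
    works with \<open>S \<inter> V\<close>.\<close>
  have "2 * l \<le> card S" if S: "finite S" "separates ?E ?A K S" for S
  proof (rule ccontr)
    assume "\<not> 2 * l \<le> card S"
    moreover have "card (S \<inter> V) \<le> card S" using S(1) by (simp add: card_mono)
    ultimately have less: "card (S \<inter> V) < 2 * l" by linarith
    have "\<not> ?A \<subseteq> S \<inter> V" "\<not> K \<subseteq> S \<inter> V"
      using less cA K(2) S(1) card_mono[of "S \<inter> V" ?A] card_mono[of "S \<inter> V" K] by auto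
    then obtain x y where xy: "x \<in> ?A" "x \<notin> S \<inter> V" "y \<in> K" "y \<notin> S \<inter> V" by blast
    then have "(x, y) \<in> rtrancl_on (V - S \<inter> V) E"
      using conn less st(4) K(1) unfolding vertex_connected_def by blast
    from rtrancl_on_path[OF this] obtain p where
      p: "walk E p" "set p \<subseteq> V - S \<inter> V" "hd p = x" "last p = y" by (auto simp: path_in_def)
    have "walk ?E p" using p by (intro walk_Int) auto
    then have "set p \<inter> S \<noteq> {}" using S(2) p(3,4) xy unfolding separates_def by blast
    then show False using p(2) by blast
  qed
  moreover have "finite ?E" using fin by simp
  ultimately obtain Q where Q: "connector ?E ?A K Q" "card Q = 2 * l"
    using menger[of ?E ?A K "2 * l"] by auto
  have "\<exists>g. (\<forall>z\<in>?A. walk ?E (g z) \<and> distinct (g z) \<and> hd (g z) = z \<and> last (g z) \<in> K) \<and>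
    disjoint_family_on (set \<circ> g) ?A \<and> (\<forall>z\<in>?A. set (g z) \<inter> ?A = {z})"
    by (rule connector_hd_index[OF Q(1)]) (use Q(2) cA in auto)
  then obtain g where g_all: "\<forall>z\<in>?A. walk ?E (g z) \<and> distinct (g z) \<and> hd (g z) = z \<and> last (g z) \<in> K"
    and fam: "disjoint_family_on (set \<circ> g) ?A" by (elim exE conjE)
  have g: "walk E (g z)" "distinct (g z)" "hd (g z) = z" "last (g z) \<in> K" "set (g z) \<subseteq> V" "g z \<noteq> []"
    if "z \<in> ?A" for z
    using bspec[OF g_all that] walk_mono[of ?E "g z" E] walk_subset[of ?E "g z" V] that st(4)
    by (auto simp: walk_def)
  have disj: "set (g z) \<inter> set (g z') = {}" if "z \<in> ?A" "z' \<in> ?A" "z \<noteq> z'" for z z'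
    using disjoint_family_onD[OF fam that] by simp
  define P where "P i = g (s ! i) @ rev (g (t ! i))" for i
  have mem: "s ! i \<in> ?A" "t ! i \<in> ?A" if "i < l" for i using that st by auto
  have neq: "s ! i \<noteq> t ! j" if "i < l" "j < l" for i j
    using that st(1,2,3) by (metis disjoint_iff distinct_append nth_mem)
  have neq': "s ! i \<noteq> s ! j" "t ! i \<noteq> t ! j" if "i < l" "j < l" "i \<noteq> j" for i j
    using that st(1,2,3) by (auto simp: nth_eq_iff_index_eq)
  have "path_in E V (P i) \<and> hd (P i) = s ! i \<and> last (P i) = t ! i" if i: "i < l" for i
  proof -
    note gs = g[OF mem(1)[OF i]] and gt = g[OF mem(2)[OF i]]
    have dj: "set (g (s ! i)) \<inter> set (g (t ! i)) = {}" using disj mem neq i by blast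
    then have "last (g (s ! i)) \<noteq> last (g (t ! i))"
      using gs(6) gt(6) by (metis disjoint_iff last_in_set)
    then have "(last (g (s ! i)), last (g (t ! i))) \<in> E" using K(3) gs(4) gt(4) by blast
    then have "walk E (P i)"
      unfolding P_def using gs(1,6) gt(1,6) walk_rev[OF sym] by (simp add: walk_append hd_rev)
    then show ?thesis using gs gt dj by (auto simp: P_def path_in_def last_rev)
  qed
  moreover have "disjoint_family_on (\<lambda>i. set (P i)) {..<l}"
    unfolding disjoint_family_on_def
  proof (intro ballI impI)
    fix i j assume ij: "i \<in> {..<l}" "j \<in> {..<l}" "i \<noteq> j"
    then have ij': "i < l" "j < l" by auto
    note m = mem[OF ij'(1)] mem[OF ij'(2)]
    show "set (P i) \<inter> set (P j) = {}"
      using disj[OF m(1) m(3) neq'(1)[OF ij' ij(3)]] disj[OF m(1) m(4) neq[OF ij']]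
        disj[OF m(2) m(3) neq[OF ij'(2,1), symmetric]] disj[OF m(2) m(4) neq'(2)[OF ij' ij(3)]]
      by (auto simp: P_def)
  qed
  ultimately show ?thesis unfolding linkage_def by blast
qed

text \<open>
  A shortest path from \<open>s\<close> to \<open>t\<close> of length \<open>n\<close> passes through the distance layers
  \<open>L 1, \<dots>, L (n - 1)\<close>, each of which separates \<open>s\<close> from \<open>t\<close> and so contains two nonadjacent
  vertices. Choosing such a pair in every second layer (and \<open>s\<close> in layer 0) gives an independent
  set of size \<open>n\<close>.
\<close>

lemma short_path:
  assumes sym: "sym E" and irrefl: "irrefl E" and st: "(s, t) \<in> rtrancl_on W E" "s \<noteq> t"
    and sep: "\<And>L. L \<subseteq> W - {s, t} \<Longrightarrow> (s, t) \<notin> rtrancl_on (W - L) E \<Longrightarrow>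
      \<exists>a\<in>L. \<exists>b\<in>L. a \<noteq> b \<and> (a, b) \<notin> E"
    and alpha: "\<And>S. S \<subseteq> W \<Longrightarrow> indep E S \<Longrightarrow> card S < k"
  shows "\<exists>p. path_in E W p \<and> hd p = s \<and> last p = t \<and> length p \<le> k"
proof -
  define R where "R = E \<inter> W \<times> W"
  \<comment> \<open>The distance from \<open>s\<close> within \<open>W\<close>. It is meaningless
    for unreachable vertices, so the layers \<open>L i\<close> demand reachability.\<close>
  define D where "D v = (LEAST n. (s, v) \<in> R ^^ n)" for v
  have W: "s \<in> W" "t \<in> W" using st(1) by (auto dest: in_rtrancl_on_in_F)
  have D: "(s, v) \<in> R ^^ D v" if "(s, v) \<in> R\<^sup>*" for v
    using that unfolding D_def by (metis LeastI rtrancl_imp_relpow)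
  have D_le: "D v \<le> n" if "(s, v) \<in> R ^^ n" for v n
    using that unfolding D_def by (rule Least_le)
  have D_Suc: "D v \<le> Suc (D u)" if "(s, u) \<in> R\<^sup>*" "(u, v) \<in> R" for u v
    by (rule D_le) (use D[OF that(1)] that(2) in auto)
  have reach: "(s, v) \<in> R\<^sup>*" if "(s, v) \<in> rtrancl_on W E" for v
    using that
  proof (induction rule: rtrancl_on_induct)
    case (step y z)
    then show ?case by (auto simp: R_def intro: rtrancl_into_rtrancl)
  qed simp
  have RW: "v \<in> W" if "(s, v) \<in> R\<^sup>*" for v
    using that W(1) by (auto simp: R_def elim: rtranclE)
  define n where "n = D t"
  have tn: "(s, t) \<in> R ^^ n" unfolding n_def by (rule D[OF reach[OF st(1)]])
  have n0: "n > 0" using tn st(2) by (cases n) auto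
  define L where "L i = {v. (s, v) \<in> R\<^sup>* \<and> D v = i}" for i
  have D0: "D s = 0" using D_le[of s 0] by simp
  have pair: "\<exists>a b. a \<in> L i \<and> b \<in> L i \<and> a \<noteq> b \<and> (a, b) \<notin> E" if i: "0 < i" "i < n" for i
  proof -
    have LW: "L i \<subseteq> W - {s, t}" using i RW D0 by (auto simp: L_def n_def)
    \<comment> \<open>Along an arc the distance grows by at most one, so a walk that avoids layer
      \<open>i\<close> can never get past it.\<close>
    have low: "(s, v) \<in> R\<^sup>* \<and> D v < i" if "(s, v) \<in> rtrancl_on (W - L i) E" for v
      using that
    proof (induction rule: rtrancl_on_induct)
      case base
      then show ?case using D0 i by simp
    next
      case (step y z)
      then have yz: "(y, z) \<in> R" by (auto simp: R_def)
      then have "(s, z) \<in> R\<^sup>*" using step by auto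
      moreover have "D z \<le> i" using D_Suc[OF _ yz] step by fastforce
      moreover have "z \<notin> L i" using step by simp
      ultimately show ?case by (auto simp: L_def)
    qed
    have "(s, t) \<notin> rtrancl_on (W - L i) E" using low[of t] i unfolding n_def by auto
    then show ?thesis using sep[OF LW] by blast
  qed
  have step_le: "D v \<le> Suc (D u)" if "(s, u) \<in> R\<^sup>*" "(s, v) \<in> R\<^sup>*" "(u, v) \<in> E" for u v
    using D_Suc[OF that(1), of v] RW that by (auto simp: R_def)
  \<comment> \<open>The induction goes in steps of two: a pair in layer \<open>i + 2\<close> has no
    arcs to vertices of distance at most \<open>i\<close>. It starts with \<open>s\<close> for even
    \<open>i\<close> and with a pair in layer 1 for odd \<open>i\<close>.\<close>
  have "\<exists>J. finite J \<and> card J = Suc i \<and> indep E J \<and> (\<forall>v\<in>J. (s, v) \<in> R\<^sup>* \<and> D v \<le> i)"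
    if "i < n" for i
    using that
  proof (induction i rule: induct_nat_012)
    case 0
    then show ?case using irrefl D0
      by (intro exI[of _ "{s}"]) (auto simp: indep_def irrefl_def)
  next
    case 1
    then obtain a b where "a \<in> L 1" "b \<in> L 1" "a \<noteq> b" "(a, b) \<notin> E" using pair[of 1] by auto
    then show ?case using irrefl sym
      by (intro exI[of _ "{a, b}"]) (auto simp: indep_def irrefl_def L_def dest: symD)
  next
    case (ge2 i)
    then obtain J where J: "finite J" "card J = Suc i" "indep E J" "\<forall>v\<in>J. (s, v) \<in> R\<^sup>* \<and> D v \<le> i"
      by auto
    obtain a b where ab: "a \<in> L (Suc (Suc i))" "b \<in> L (Suc (Suc i))" "a \<noteq> b" "(a, b) \<notin> E"
      using pair[of "Suc (Suc i)"] ge2 by auto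
    have far: "x \<notin> J \<and> (\<forall>v\<in>J. (v, x) \<notin> E \<and> (x, v) \<notin> E)" if "x \<in> L (Suc (Suc i))" for x
    proof -
      have "(v, x) \<notin> E" if "v \<in> J" for v
        using step_le[of v x] J(4) \<open>x \<in> _\<close> that by (fastforce simp: L_def)
      then show ?thesis using J(4) that sym by (fastforce simp: L_def dest: symD)
    qed
    have "indep E (insert a (insert b J))"
      using J(3) far[OF ab(1)] far[OF ab(2)] ab(4) irrefl sym
      unfolding indep_def irrefl_def by (blast dest: symD)
    moreover have "card (insert a (insert b J)) = Suc (Suc (Suc i))"
      using J(1,2) far[OF ab(1)] far[OF ab(2)] ab(3) by simp
    moreover have "\<forall>v\<in>insert a (insert b J). (s, v) \<in> R\<^sup>* \<and> D v \<le> Suc (Suc i)"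
      using J(4) ab(1,2) by (auto simp: L_def)
    ultimately show ?case using J(1) by (meson finite_insert)
  qed
  from this[of "n - 1"] n0 obtain J where
    J: "card J = n" "indep E J" "\<forall>v\<in>J. (s, v) \<in> R\<^sup>*" by auto
  have "J \<subseteq> W" using J(3) RW by blast
  then have nk: "n < k" using alpha[OF _ J(2)] J(1) by simp
  obtain f where f: "f 0 = s" "f n = t" "\<forall>i<n. (f i, f (Suc i)) \<in> R"
    using tn unfolding relpow_fun_conv by blast
  \<comment> \<open>Otherwise the walk to \<open>f i\<close> could be shortened, and with it the one
    to \<open>t\<close>. Distinct distances make \<open>p\<close> a path.\<close>
  have fD: "D (f i) = i" if "i \<le> n" for i
  proof -
    have 1: "(s, f i) \<in> R ^^ i"
      unfolding relpow_fun_conv using f that by (intro exI[of _ f]) auto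
    have "(f i, t) \<in> R ^^ (n - i)"
      unfolding relpow_fun_conv using f that by (intro exI[of _ "\<lambda>j. f (i + j)"]) auto
    moreover have "(s, f i) \<in> R ^^ D (f i)" using D 1 relpow_imp_rtrancl by metis
    ultimately have "(s, t) \<in> R ^^ (D (f i) + (n - i))" by (auto simp: relpow_add)
    then have "n \<le> D (f i) + (n - i)" unfolding n_def by (rule D_le)
    then show ?thesis using D_le[OF 1] that by linarith
  qed
  define p where "p = map f [0..<Suc n]"
  have "inj_on f {0..<Suc n}"
    by (rule inj_onI) (metis fD atLeastLessThan_iff less_Suc_eq_le)
  then have "distinct p" by (simp add: p_def distinct_map del: upt_Suc)
  moreover have "walk E p"
    using f(3) unfolding p_def walk_def
    by (auto simp: successively_conv_nth R_def simp del: upt_Suc)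
  moreover have "set p \<subseteq> W"
  proof -
    have "f i \<in> W" if "i \<le> n" for i
    proof (cases "i < n")
      case True
      then show ?thesis using f(3) by (auto simp: R_def)
    next
      case False
      then show ?thesis using that f(2) W(2) by simp
    qed
    then show ?thesis by (auto simp: p_def)
  qed
  moreover have "hd p = s" using f(1) by (simp add: p_def hd_map del: upt_Suc)
  moreover have "last p = t" "length p = Suc n" using f(2) by (simp_all add: p_def)
  ultimately show ?thesis using nk unfolding path_in_def by (intro exI[of _ p]) auto
qed

text \<open>
  Without a clique on \<open>2 * l\<close> vertices, \<open>s ! 0\<close> and \<open>t ! 0\<close> are joined by a path with at most \<open>k\<close>
  vertices avoiding the other terminals. Deleting it costs at most \<open>k\<close> in connectivity.
\<close>

lemma linkage_exists:
  assumes sym: "sym E" and irrefl: "irrefl E" and k: "4 \<le> k"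
  shows "finite V \<Longrightarrow> vertex_connected E V (k * l) \<Longrightarrow> (\<And>S. S \<subseteq> V \<Longrightarrow> indep E S \<Longrightarrow> card S < k) \<Longrightarrow>
    length s = l \<Longrightarrow> length t = l \<Longrightarrow> distinct (s @ t) \<Longrightarrow> set (s @ t) \<subseteq> V \<Longrightarrow>
    \<exists>P. linkage E V l s t P"
proof (induction l arbitrary: V s t)
  case 0
  then show ?case by (simp add: linkage_def disjoint_family_on_def)
next
  case (Suc l)
  note fin = Suc.prems(1) and conn = Suc.prems(2) and alpha = Suc.prems(3)
  \<comment> \<open>The factor 4 covers the \<open>2 * l\<close> other terminals plus the
    \<open>2 * Suc l\<close> vertices that a layer must have so as not to be a clique.\<close>
  have k4: "4 * Suc l \<le> k * Suc l" using k by (rule mult_le_mono1)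
  show ?case
  proof (cases "\<exists>K\<subseteq>V. 2 * Suc l \<le> card K \<and> (\<forall>u\<in>K. \<forall>v\<in>K. u \<noteq> v \<longrightarrow> (u, v) \<in> E)")
    case True
    then obtain K where K: "K \<subseteq> V" "2 * Suc l \<le> card K" "\<forall>u\<in>K. \<forall>v\<in>K. u \<noteq> v \<longrightarrow> (u, v) \<in> E"
      by blast
    have "vertex_connected E V (2 * Suc l)"
      by (rule vertex_connected_mono[OF conn]) (use k4 in simp)
    then show ?thesis
      using clique_linkage[OF fin sym _ K(1,2)] K(3) Suc.prems(4-) by blast
  next
    case noK: False
    obtain a s' where s: "s = a # s'" using Suc.prems(4) by (cases s) auto
    obtain b t' where t: "t = b # t'" using Suc.prems(5) by (cases t) auto
    define X where "X = set (s' @ t')"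
    have len: "length s' = l" "length t' = l" and dist: "distinct (s' @ t')"
      and ab: "a \<noteq> b" "a \<notin> X" "b \<notin> X" "a \<in> V" "b \<in> V" and XV: "X \<subseteq> V" and finX: "finite X"
      using Suc.prems(4-) by (auto simp: s t X_def)
    have cX: "card X = 2 * l" using distinct_card[OF dist] len by (simp add: X_def)
    have "card X < k * Suc l" using k4 cX by simp
    then have reach: "(a, b) \<in> rtrancl_on (V - X) E"
      using conn ab XV unfolding vertex_connected_def by blast
    have "\<exists>p. path_in E (V - X) p \<and> hd p = a \<and> last p = b \<and> length p \<le> k"
    proof (rule short_path[OF sym irrefl reach ab(1)])
      fix L assume L: "L \<subseteq> V - X - {a, b}" "(a, b) \<notin> rtrancl_on (V - X - L) E"
      have "V - X - L = V - (X \<union> L)" by blast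
      moreover have "X \<union> L \<subseteq> V" "a \<in> V - (X \<union> L)" "b \<in> V - (X \<union> L)" using L XV ab by auto
      \<comment> \<open>The other terminals and \<open>L\<close> together separate \<open>a\<close>
        from \<open>b\<close>.\<close>
      ultimately have "\<not> card (X \<union> L) < k * Suc l"
        using L(2) conn unfolding vertex_connected_def by (metis (no_types, lifting))
      moreover have "card (X \<union> L) \<le> card X + card L" by (rule card_Un_le)
      ultimately have "4 * Suc l \<le> card X + card L" using k4 by (meson le_trans not_less)
      then have "2 * Suc l \<le> card L" using cX by simp
      moreover have "L \<subseteq> V" using L(1) by blast
      ultimately show "\<exists>a\<in>L. \<exists>b\<in>L. a \<noteq> b \<and> (a, b) \<notin> E" using noK by blast
    qed (use alpha in blast)
    then obtain p where p: "path_in E (V - X) p" "hd p = a" "last p = b" "length p \<le> k" by blast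
    let ?V = "V - set p"
    have "vertex_connected E ?V (k * l)"
      unfolding vertex_connected_def
    proof (intro allI impI ballI)
      fix A u v assume A: "A \<subseteq> ?V" "card A < k * l" and uv: "u \<in> ?V - A" "v \<in> ?V - A"
      have eq: "?V - A = V - (A \<union> set p)" by blast
      have "card (A \<union> set p) \<le> card A + card (set p)" by (rule card_Un_le)
      also have "\<dots> < k * Suc l" using A(2) p(4) card_length[of p] by simp
      finally have "card (A \<union> set p) < k * Suc l" .
      moreover have "A \<union> set p \<subseteq> V" using A(1) p(1) by (auto simp: path_in_def)
      ultimately show "(u, v) \<in> rtrancl_on (?V - A) E"
        using conn uv unfolding vertex_connected_def eq by blast
    qed
    moreover have "set (s' @ t') \<subseteq> ?V" using XV p(1) by (auto simp: X_def path_in_def)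
    moreover have "\<And>S. S \<subseteq> ?V \<Longrightarrow> indep E S \<Longrightarrow> card S < k" using alpha by blast
    ultimately obtain P where P: "linkage E ?V l s' t' P"
      using Suc.IH[of ?V s' t'] fin len dist by blast
    have PV: "set (P i) \<inter> set p = {}" if "i < l" for i
      using P that by (auto simp: linkage_def path_in_def)
    have "linkage E V (Suc l) s t (case_nat p P)"
      unfolding linkage_def
    proof (intro conjI allI impI)
      fix i assume "i < Suc l"
      then show "path_in E V (case_nat p P i)" "hd (case_nat p P i) = s ! i"
        "last (case_nat p P i) = t ! i"
        using p P by (auto simp: s t linkage_def split: nat.split intro: path_in_mono)
    next
      show "disjoint_family_on (\<lambda>i. set (case_nat p P i)) {..<Suc l}"
        unfolding disjoint_family_on_def
      proof (intro ballI impI)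
        fix i j assume "i \<in> {..<Suc l}" "j \<in> {..<Suc l}" "i \<noteq> j"
        moreover have "disjoint_family_on (\<lambda>i. set (P i)) {..<l}" using P by (simp add: linkage_def)
        ultimately show "set (case_nat p P i) \<inter> set (case_nat p P j) = {}"
          using PV by (auto simp: Int_commute disjoint_family_on_def split: nat.split)
      qed
    qed
    then show ?thesis by blast
  qed
qed

section \<open>From an arbitrary linkage to a spanning one\<close>

lemma linkage_reroute:
  assumes P: "linkage E V l s t P" and i: "i < l"
    and q: "path_in E V q" "hd q = hd (P i)" "last q = last (P i)"
    and setq: "set q = set (P i) \<union> H" and H: "H \<inter> (\<Union>j<l. set (P j)) = {}"
  shows "linkage E V l s t (P(i := q))"
    and "(\<Union>j<l. set ((P(i := q)) j)) = (\<Union>j<l. set (P j)) \<union> H"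
proof -
  have dj: "set (P m) \<inter> set (P n) = {}" if "m < l" "n < l" "m \<noteq> n" for m n
    using P that unfolding linkage_def disjoint_family_on_def by auto
  have "disjoint_family_on (\<lambda>j. set ((P(i := q)) j)) {..<l}"
    unfolding disjoint_family_on_def
  proof (intro ballI impI)
    fix m n assume mn: "m \<in> {..<l}" "n \<in> {..<l}" "m \<noteq> n"
    have "H \<inter> set (P j) = {}" if "j < l" for j using H that by blast
    then show "set ((P(i := q)) m) \<inter> set ((P(i := q)) n) = {}"
      using mn dj[of m n] setq by (cases "m = i"; cases "n = i") auto
  qed
  then show "linkage E V l s t (P(i := q))"
    using P q i by (auto simp: linkage_def)
  show "(\<Union>j<l. set ((P(i := q)) j)) = (\<Union>j<l. set (P j)) \<union> H"
  proof (intro equalityI subsetI)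
    fix x assume "x \<in> (\<Union>j<l. set ((P(i := q)) j))"
    then obtain j where "j < l" "x \<in> set ((P(i := q)) j)" by blast
    then show "x \<in> (\<Union>j<l. set (P j)) \<union> H" using setq i by (cases "j = i") auto
  next
    fix x assume "x \<in> (\<Union>j<l. set (P j)) \<union> H"
    then consider j where "j < l" "x \<in> set (P j)" | "x \<in> H" by blast
    then show "x \<in> (\<Union>j<l. set ((P(i := q)) j))"
    proof cases
      case 1
      then show ?thesis using setq by (intro UN_I[of j]) auto
    next
      case 2
      then show ?thesis using setq i by (intro UN_I[of i]) auto
    qed
  qed
qed

text \<open>
  The argument of Chvatal and Erdos: \<open>H\<close> is a component outside a linkage covering as many vertices
  as possible. Some path contains \<open>k\<close> neighbours of \<open>H\<close>; their successors on the path together with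
  a vertex of \<open>H\<close> are independent, as otherwise the path could be rerouted through \<open>H\<close>.
\<close>

lemma spanning_linkage:
  assumes fin: "finite V" and sym: "sym E" and irrefl: "irrefl E" and l: "0 < l"
    and conn: "vertex_connected E V (k * l)"
    and alpha: "\<And>S. S \<subseteq> V \<Longrightarrow> indep E S \<Longrightarrow> card S < k"
    and st: "length s = l" "length t = l" "distinct (s @ t)"
    and P0: "linkage E V l s t P0"
  shows "\<exists>P. linkage E V l s t P \<and> (\<Union>i<l. set (P i)) = V"
proof -
  have sub: "(\<Union>i<l. set (P i)) \<subseteq> V" if "linkage E V l s t P" for P
    using that by (auto simp: linkage_def path_in_def)
  have "\<exists>P. linkage E V l s t P \<and>
      (\<forall>P'. linkage E V l s t P' \<longrightarrow> card (\<Union>i<l. set (P' i)) \<le> card (\<Union>i<l. set (P i)))"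
  proof (rule ex_has_greatest_nat[where P = "linkage E V l s t" and k = P0 and b = "Suc (card V)"])
    show "\<forall>P. linkage E V l s t P \<longrightarrow> card (\<Union>i<l. set (P i)) < Suc (card V)"
      using sub card_mono[OF fin] by (simp add: less_Suc_eq_le)
  qed (rule P0)
  then obtain P where P: "linkage E V l s t P"
    and max: "\<And>P'. linkage E V l s t P' \<Longrightarrow> card (\<Union>i<l. set (P' i)) \<le> card (\<Union>i<l. set (P i))"
    by blast
  define U where "U = (\<Union>i<l. set (P i))"
  have UV: "U \<subseteq> V" using sub[OF P] by (simp add: U_def)
  have finU: "finite U" by (simp add: U_def)
  have PU: "set (P i) \<subseteq> U" if "i < l" for i using that by (auto simp: U_def)
  have "U = V"
  proof (rule ccontr)
    assume "U \<noteq> V"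
    then obtain v where v: "v \<in> V" "v \<notin> U" using UV by blast
    define H where "H = {w. (v, w) \<in> rtrancl_on (V - U) E}"
    define N where "N = {x \<in> U. \<exists>h\<in>H. (h, x) \<in> E}"
    have HV: "H \<subseteq> V - U" by (auto simp: H_def dest: in_rtrancl_on_in_F)
    have vH: "v \<in> H" using v by (simp add: H_def)
    \<comment> \<open>Maximality in the form used below: no path can be replaced by one with the
      same ends that keeps its vertices and takes in a nonempty list \<open>h\<close> of uncovered
      ones.\<close>
    have ext: False
      if "i < l" "walk E q" "distinct q" "hd q = hd (P i)" "last q = last (P i)"
        "set q = set (P i) \<union> set h" "h \<noteq> []" "set h \<subseteq> V - U" for i q h
    proof -
      have "path_in E V (P i)" using P that(1) by (auto simp: linkage_def)
      then have q: "path_in E V q" using that by (auto simp: path_in_def)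
      have h: "set h \<inter> (\<Union>j<l. set (P j)) = {}" using that(8) by (auto simp: U_def)
      note r = linkage_reroute[OF P that(1) q that(4,5,6) h]
      have "card U < card (U \<union> set h)"
        using that(7,8) finU by (intro psubset_card_mono) (auto simp: neq_Nil_conv)
      then show False using max[OF r(1)] unfolding r(2) U_def by simp
    qed
    have symrt: "(x, y) \<in> rtrancl_on (V - U) E \<Longrightarrow> (y, x) \<in> rtrancl_on (V - U) E" for x y
      by (metis rtrancl_on_sym sym symD)
    have detour: "\<exists>h. h \<noteq> [] \<and> walk E h \<and> distinct h \<and> set h \<subseteq> V - U \<and> (x, hd h) \<in> E \<and> (last h, y) \<in> E"
      if "x \<in> N" "y \<in> N" for x y
    proof -
      obtain x' y' where xy: "x' \<in> H" "(x', x) \<in> E" "y' \<in> H" "(y', y) \<in> E"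
        using \<open>x \<in> N\<close> \<open>y \<in> N\<close> by (auto simp: N_def)
      then have "(x', y') \<in> rtrancl_on (V - U) E"
        using symrt unfolding H_def by (blast intro: rtrancl_on_trans)
      from rtrancl_on_path[OF this] obtain h where
        "path_in E (V - U) h" "hd h = x'" "last h = y'" by blast
      then show ?thesis using xy sym by (intro exI[of _ h]) (auto simp: path_in_def walk_def dest: symD)
    qed
    \<comment> \<open>Two consecutive vertices of a path cannot both have neighbours in
      \<open>H\<close>, as a detour would fit between them.\<close>
    have insertion: False
      if i: "i < l" and p: "P i = a @ b" and ne: "a \<noteq> []" "b \<noteq> []" and N: "last a \<in> N" "hd b \<in> N" for i a b
    proof -
      obtain h where h: "h \<noteq> []" "walk E h" "distinct h" "set h \<subseteq> V - U"
        "(last a, hd h) \<in> E" "(last h, hd b) \<in> E" using detour[OF N] by blast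
      have w: "walk E (a @ b)" "distinct (a @ b)" "set (a @ b) \<subseteq> U"
        using P i PU[OF i] unfolding p[symmetric] by (auto simp: linkage_def path_in_def)
      have "walk E (a @ h @ b)" using w(1) h ne by (simp add: walk_append)
      moreover have "distinct (a @ h @ b)" using w h by auto
      ultimately show False
        using ne h by (intro ext[OF i, of "a @ h @ b" h]) (auto simp: p)
    qed
    \<comment> \<open>Run along \<open>a\<close>, detour to the end of \<open>b\<close>, go back
      through \<open>b\<close> and use the arc from \<open>hd b\<close> to
      \<open>hd c\<close>.\<close>
    have crossing: False
      if i: "i < l" and p: "P i = a @ b @ c" and ne: "a \<noteq> []" "b \<noteq> []" "c \<noteq> []"
        and N: "last a \<in> N" "last b \<in> N" and bc: "(hd b, hd c) \<in> E" for i a b c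
    proof -
      obtain h where h: "h \<noteq> []" "walk E h" "distinct h" "set h \<subseteq> V - U"
        "(last a, hd h) \<in> E" "(last h, last b) \<in> E" using detour[OF N] by blast
      have w: "walk E (a @ b @ c)" "distinct (a @ b @ c)" "set (a @ b @ c) \<subseteq> U"
        using P i PU[OF i] unfolding p[symmetric] by (auto simp: linkage_def path_in_def)
      have "walk E (a @ h @ rev b @ c)"
        using w(1) h ne bc walk_rev[OF sym, of b] by (simp add: walk_append hd_rev last_rev)
      moreover have "distinct (a @ h @ rev b @ c)" using w h by auto
      ultimately show False
        using ne h by (intro ext[OF i, of "a @ h @ rev b @ c" h]) (auto simp: p)
    qed
    have long: "2 \<le> length (P i)" if "i < l" for i
    proof -
      have "s ! i \<noteq> t ! i" using that st by (metis disjoint_iff distinct_append nth_mem)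
      then have "hd (P i) \<noteq> last (P i)" and "P i \<noteq> []"
        using P that by (auto simp: linkage_def path_in_def walk_def)
      then show ?thesis by (cases "P i"; cases "tl (P i)") auto
    qed
    \<comment> \<open>Otherwise \<open>N\<close> would have fewer than \<open>k * l\<close> vertices
      and \<open>V - N\<close> would remain connected. But a walk from \<open>v\<close> leaves
      \<open>H\<close> only through \<open>N\<close>, so all of \<open>U\<close> would lie in
      \<open>N\<close>, against \<open>insertion\<close> at the first two vertices of
      \<open>P 0\<close>.\<close>
    have "\<exists>i<l. k \<le> card (N \<inter> set (P i))"
    proof (rule ccontr)
      assume "\<not> (\<exists>i<l. k \<le> card (N \<inter> set (P i)))"
      then have small: "card (N \<inter> set (P i)) < k" if "i < l" for i using that by (meson not_le)
      have k0: "0 < k" using small[OF l] by simp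
      have "N = (\<Union>i<l. N \<inter> set (P i))" by (auto simp: N_def U_def)
      then have "card N \<le> (\<Sum>i<l. card (N \<inter> set (P i)))" by (metis card_UN_le finite_lessThan)
      also have "\<dots> < (\<Sum>i<l. k)"
        by (rule sum_strict_mono) (use small l in auto)
      finally have "card N < k * l" by (simp add: mult.commute)
      have all: "(u, w) \<in> rtrancl_on (V - N) E" if "u \<in> V - N" "w \<in> V - N" for u w
      proof -
        have "N \<subseteq> V" using UV by (auto simp: N_def)
        then show ?thesis using conn[unfolded vertex_connected_def] \<open>card N < k * l\<close> that by simp
      qed
      have "w \<in> H" if "(v, w) \<in> rtrancl_on (V - N) E" for w
        using that
      proof (induction rule: rtrancl_on_induct)
        case base
        show ?case by (rule vH)
      next
        case (step y z)
        then have "z \<in> V - U" by (auto simp: N_def)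
        then show ?case using step unfolding H_def by (auto intro: rtrancl_on_into_rtrancl_on)
      qed
      then have "V - N \<subseteq> H" using all[of v] v by (auto simp: N_def)
      then have "U \<subseteq> N" using HV UV by blast
      moreover obtain x y b where P0': "P 0 = x # y # b"
        using long[OF l] by (cases "P 0"; cases "tl (P 0)") auto
      moreover have "set (P 0) \<subseteq> U" by (rule PU[OF l])
      ultimately show False using insertion[OF l, of "[x]" "y # b"] by auto
    qed
    then obtain i where i: "i < l" and big: "k \<le> card (N \<inter> set (P i))" by blast
    define p where "p = P i"
    have p: "walk E p" "distinct p" "set p \<subseteq> U" "p \<noteq> []"
      using P i PU[OF i] by (auto simp: p_def linkage_def path_in_def walk_def)
    \<comment> \<open>The last vertex has no successor, so at least \<open>k - 1\<close> positions
      remain; adding \<open>v\<close> to the successors makes up for the lost one.\<close>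
    define I where "I = {j. Suc j < length p \<and> p ! j \<in> N}"
    have finI: "finite I" by (rule finite_subset[of _ "{..<length p}"]) (auto simp: I_def)
    have "N \<inter> set p \<subseteq> insert (last p) ((!) p ` I)"
    proof
      fix x assume x: "x \<in> N \<inter> set p"
      then obtain j where j: "j < length p" "p ! j = x" by (auto simp: in_set_conv_nth)
      show "x \<in> insert (last p) ((!) p ` I)"
      proof (cases "Suc j = length p")
        case True
        then have "j = length p - 1" by simp
        then show ?thesis using j last_conv_nth[OF p(4)] by simp
      next
        case False
        then show ?thesis using j x by (auto simp: I_def)
      qed
    qed
    then have "card (N \<inter> set p) \<le> card (insert (last p) ((!) p ` I))"
      using finI by (intro card_mono) auto
    also have "\<dots> \<le> Suc (card ((!) p ` I))" by (rule card_insert_le_m1[THEN le_trans]) auto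
    also have "\<dots> \<le> Suc (card I)" using card_image_le[OF finI] by simp
    finally have cI: "k \<le> Suc (card I)" using big by (simp add: p_def)
    define Y where "Y = (\<lambda>j. p ! Suc j) ` I"
    have "inj_on (\<lambda>j. p ! Suc j) I"
      using p(2) by (auto intro!: inj_onI simp: I_def nth_eq_iff_index_eq)
    then have cY: "card Y = card I" by (simp add: Y_def card_image)
    have YU: "Y \<subseteq> U" using p(3) by (auto simp: Y_def I_def)
    have YN: "p ! Suc j \<notin> N" if "j \<in> I" for j
    proof
      assume N: "p ! Suc j \<in> N"
      have j: "Suc j < length p" "p ! j \<in> N" using that by (auto simp: I_def)
      have "P i = take (Suc j) p @ drop (Suc j) p" by (simp add: p_def)
      moreover have "take (Suc j) p \<noteq> []" "drop (Suc j) p \<noteq> []" using j by auto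
      moreover have "last (take (Suc j) p) = p ! j" "hd (drop (Suc j) p) = p ! Suc j"
        using j by (simp_all add: take_Suc_conv_app_nth hd_drop_conv_nth)
      ultimately show False using insertion[OF i] j N by metis
    qed
    have YY: "(p ! Suc j, p ! Suc j') \<notin> E" if "j \<in> I" "j' \<in> I" "j < j'" for j j'
    proof
      assume e: "(p ! Suc j, p ! Suc j') \<in> E"
      have j: "Suc j < length p" "p ! j \<in> N" "Suc j' < length p" "p ! j' \<in> N"
        using that by (auto simp: I_def)
      \<comment> \<open>The cuts are made just before the two successors: \<open>?a\<close> ends in
        \<open>p ! j\<close>, \<open>?b\<close> runs from \<open>p ! Suc j\<close> to
        \<open>p ! j'\<close>, and \<open>?c\<close> starts with \<open>p ! Suc j'\<close>.\<close>
      let ?a = "take (Suc j) p" and ?b = "drop (Suc j) (take (Suc j') p)" and ?c = "drop (Suc j') p"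
      have ab: "take (Suc j') p = ?a @ ?b"
        using that(3) append_take_drop_id[of "Suc j" "take (Suc j') p"] by (simp add: min_def)
      then have "P i = ?a @ ?b @ ?c"
        by (metis append.assoc append_take_drop_id p_def)
      moreover have ne: "?a \<noteq> []" "?b \<noteq> []" "?c \<noteq> []" using j that(3) by auto
      moreover have "last ?a = p ! j" "last ?b = p ! j'" "hd ?c = p ! Suc j'"
        using j that(3) ne(2) by (simp_all add: take_Suc_conv_app_nth hd_drop_conv_nth)
      moreover have "hd ?b = p ! Suc j" using j that(3) by (simp add: hd_drop_conv_nth)
      ultimately show False using crossing[OF i, of ?a ?b ?c] j e by simp
    qed
    have "indep E (insert v Y)"
    proof -
      have irr: "(x, x) \<notin> E" for x using irrefl by (simp add: irrefl_def)
      have vy: "(v, y) \<notin> E" if "y \<in> Y" for y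
        using that YN YU vH by (auto simp: Y_def N_def)
      have "(x, y) \<notin> E" if xy: "x \<in> Y" "y \<in> Y" for x y
      proof -
        obtain j j' where "j \<in> I" "j' \<in> I" "x = p ! Suc j" "y = p ! Suc j'"
          using xy by (auto simp: Y_def)
        then show ?thesis
          using YY[of j j'] YY[of j' j] irr symD[OF sym] by (cases j j' rule: linorder_cases) auto
      qed
      then show ?thesis using irr vy symD[OF sym] unfolding indep_def by blast
    qed
    moreover have "insert v Y \<subseteq> V" using v YU UV by auto
    moreover have "card (insert v Y) = Suc (card I)"
      using v(2) YU finI cY by (subst card_insert_disjoint) (auto simp: Y_def)
    ultimately show False using alpha[of "insert v Y"] cI by simp
  qed
  then show ?thesis using P by (auto simp: U_def)
qed

section \<open>Transfer to graphs\<close>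

lemma arcs_ends_induce: "arcs_ends (G \<restriction> W) = arcs_ends G \<inter> W \<times> W"
  by (auto simp: arcs_ends_def arc_to_ends_def)

lemma vpath_conv_path_in: "vpath p G \<longleftrightarrow> path_in (arcs_ends G) (verts G) p"
proof -
  have "p \<noteq> [] \<Longrightarrow> set (vwalk_arcs p) \<subseteq> arcs_ends G \<longleftrightarrow> walk (arcs_ends G) p"
    by (induction p rule: vwalk_arcs.induct) auto
  then show ?thesis by (auto simp: vpath_def vwalk_def path_in_def walk_def)
qed

context graph
begin

lemma sym_arcs_ends: "sym (arcs_ends G)"
  using sym_arcs by (simp add: symmetric_def)

lemma irrefl_arcs_ends: "irrefl (arcs_ends G)"
  using no_loops by (fastforce simp: irrefl_def arcs_ends_def arc_to_ends_def)

text \<open>\<open>connected\<close> refers to the symmetric closure, which gives the same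
  reachability since the arcs are symmetric. Inducing on \<open>W\<close> removes no arc that
  \<open>rtrancl_on W\<close> can use.\<close>

lemma connected_induce_iff:
  "Digraph_Component.connected (G \<restriction> W) \<longleftrightarrow>
     W \<noteq> {} \<and> (\<forall>u\<in>W. \<forall>v\<in>W. (u, v) \<in> rtrancl_on W (arcs_ends G))"
proof -
  interpret H: wf_digraph "G \<restriction> W" by (rule wellformed_induce_subgraph)
  have sym: "symmetric (G \<restriction> W)"
    using sym_arcs_ends by (auto simp: symmetric_def arcs_ends_induce sym_def)
  have "rtrancl_on W (arcs_ends G \<inter> W \<times> W) = rtrancl_on W (arcs_ends G)"
  proof (intro equalityI subrelI)
    fix u v assume "(u, v) \<in> rtrancl_on W (arcs_ends G \<inter> W \<times> W)"
    then show "(u, v) \<in> rtrancl_on W (arcs_ends G)"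
      by (induction rule: rtrancl_on_induct) (auto intro: rtrancl_on_into_rtrancl_on)
  next
    fix u v assume "(u, v) \<in> rtrancl_on W (arcs_ends G)"
    then show "(u, v) \<in> rtrancl_on W (arcs_ends G \<inter> W \<times> W)"
      by (induction rule: rtrancl_on_induct) (auto intro: rtrancl_on_into_rtrancl_on)
  qed
  then have "u \<rightarrow>\<^sup>*\<^bsub>mk_symmetric (G \<restriction> W)\<^esub> v \<longleftrightarrow> (u, v) \<in> rtrancl_on W (arcs_ends G)" for u v
    unfolding H.reachable_mk_symmetric_eq[OF sym] by (simp add: reachable_def arcs_ends_induce)
  then show ?thesis
    unfolding Digraph_Component.connected_def strongly_connected_def by simp
qed

lemma finite_vertex_cuts: "finite {A. vertex_cut G A}"
  by (rule finite_subset[of _ "Pow (verts G)"]) (auto simp: vertex_cut_def)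

text \<open>All vertices except two nonadjacent ones form a cut, so the minimum in
  \<open>vertex_connectivity\<close> ranges over a nonempty set.\<close>

lemma ex_vertex_cut:
  assumes "\<not> complete_digraph (card (verts G)) G"
  shows "\<exists>A. vertex_cut G A"
proof -
  have "graph G" by unfold_locales
  then obtain u v where uv: "u \<in> verts G" "v \<in> verts G" "u \<noteq> v" "(u, v) \<notin> arcs_ends G"
    using assms irrefl_arcs_ends unfolding complete_digraph_def irrefl_def
    by (auto dest: adj_in_verts)
  have "w = u" if "(u, w) \<in> rtrancl_on {u, v} (arcs_ends G)" for w
    using that by (induction rule: rtrancl_on_induct) (use uv(4) in auto)
  then have "(u, v) \<notin> rtrancl_on {u, v} (arcs_ends G)" using uv(3) by blast
  moreover have "verts G - (verts G - {u, v}) = {u, v}" using uv by blast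
  ultimately have "vertex_cut G (verts G - {u, v})"
    using uv by (auto simp: vertex_cut_def connected_induce_iff)
  then show ?thesis by blast
qed

text \<open>A cut is a proper subset of the vertices. Positivity excludes the empty graph, where
  both numbers are 0. This provides the \<open>2 * l\<close> vertices that
  \<open>hamiltonian_linked\<close> asks for.\<close>

lemma vertex_connectivity_less_card:
  assumes "0 < vertex_connectivity G"
  shows "vertex_connectivity G < card (verts G)"
proof (cases "complete_digraph (card (verts G)) G")
  case True
  then show ?thesis using assms by (simp add: vertex_connectivity_def)
next
  case False
  then have "vertex_connectivity G \<in> card ` {A. vertex_cut G A}"
    using ex_vertex_cut[OF False] finite_vertex_cuts unfolding vertex_connectivity_def
    by (simp only: if_False) (rule Min_in, auto)
  then obtain A where "A \<subset> verts G" "vertex_connectivity G = card A" by (auto simp: vertex_cut_def)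
  then show ?thesis using psubset_card_mono[OF finite_verts] by simp
qed

text \<open>A set smaller than every cut is not a cut; in a complete graph the remaining vertices
  are equal or adjacent.\<close>

lemma vertex_connected_vertex_connectivity:
  "vertex_connected (arcs_ends G) (verts G) (vertex_connectivity G)"
  unfolding vertex_connected_def
proof (intro allI impI ballI)
  fix A u v
  assume A: "A \<subseteq> verts G" "card A < vertex_connectivity G"
    and uv: "u \<in> verts G - A" "v \<in> verts G - A"
  show "(u, v) \<in> rtrancl_on (verts G - A) (arcs_ends G)"
  proof (cases "complete_digraph (card (verts G)) G")
    case True
    then have "u = v \<or> (u, v) \<in> arcs_ends G" using uv by (auto simp: complete_digraph_def)
    then show ?thesis using uv by (auto intro: rtrancl_on_into_rtrancl_on)
  next
    case False
    have "\<not> vertex_cut G A"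
    proof
      assume "vertex_cut G A"
      then have "vertex_connectivity G \<le> card A"
        using False finite_vertex_cuts by (simp add: vertex_connectivity_def)
      then show False using A(2) by simp
    qed
    then show ?thesis using A(1) uv by (auto simp: vertex_cut_def connected_induce_iff)
  qed
qed

lemma card_indep_le_independence_number:
  assumes "S \<subseteq> verts G" "indep (arcs_ends G) S"
  shows "card S \<le> independence_number G"
proof -
  have "finite {S. independent_set G S}"
    by (rule finite_subset[of _ "Pow (verts G)"]) (auto simp: independent_set_def)
  moreover have "independent_set G S" using assms by (auto simp: independent_set_def indep_def)
  ultimately show ?thesis unfolding independence_number_def by (intro Max_ge) auto
qed

end

theorem theorem2:
  fixes G :: "('a,'b) pre_digraph" and k l :: nat
  assumes "graph G"
    and "k > 1" and "l > 0"
    and "independence_number G < k"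
    and "vertex_connectivity G \<ge> max (k * l) (10 * l)"
  shows "hamiltonian_linked l G"
proof -
  interpret graph G by fact
  let ?V = "verts G" and ?E = "arcs_ends G"
  \<comment> \<open>Passing from \<open>k\<close> to \<open>m\<close> weakens the bound on
    independent sets and turns the connectivity bound into \<open>m * l\<close>, with
    \<open>m\<close> large enough for \<open>linkage_exists\<close>.\<close>
  define m where "m = max k 10"
  have "k * l \<le> vertex_connectivity G" "10 * l \<le> vertex_connectivity G"
    using assms(5) by simp_all
  then have ml: "m * l \<le> vertex_connectivity G"
    by (cases "k \<le> 10") (simp_all add: m_def max_def)
  have conn: "vertex_connected ?E ?V (m * l)"
    by (rule vertex_connected_mono[OF vertex_connected_vertex_connectivity ml])
  have alpha: "card S < m" if "S \<subseteq> ?V" "indep ?E S" for S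
    using card_indep_le_independence_number[OF that] assms(4) by (simp add: m_def)
  have "10 * l \<le> vertex_connectivity G" using assms(5) by simp
  then have card: "2 * l \<le> card ?V"
    using vertex_connectivity_less_card assms(3) by linarith
  have "\<exists>P. (\<forall>i<l. vpath (P i) G \<and> hd (P i) = s ! i \<and> last (P i) = t ! i) \<and>
      disjoint_family_on (\<lambda>i. set (P i)) {..<l} \<and> (\<Union>i<l. set (P i)) = ?V"
    if st: "length s = l" "length t = l" "distinct (s @ t)" "set (s @ t) \<subseteq> ?V" for s t
  proof -
    have "4 \<le> m" by (simp add: m_def)
    from linkage_exists[OF sym_arcs_ends irrefl_arcs_ends this finite_verts conn alpha st]
    obtain P0 where "linkage ?E ?V l s t P0" by blast
    from spanning_linkage[OF finite_verts sym_arcs_ends irrefl_arcs_ends assms(3) conn alpha st(1-3) this]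
    show ?thesis by (simp add: linkage_def vpath_conv_path_in conj_assoc)
  qed
  then show ?thesis using card unfolding hamiltonian_linked_def by blast
qed

end
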